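(* The parametric zone graph of an extended 1-clock PTA is finite.
   Context: An extended 1-clock PTA (1cPTA) is a parametric timed automaton $(\Sigma,L,\ell_0,\{x\},P,I,E)$ with a single real-valued clock $x$, finitely many parameters $P$ (nonnegative rationals), and whose guards and invariants are conjunctions of constraints $x\sim\sum_i\alpha_ip_i+c$ with $p_i\in P$, $\alpha_i,c\in\mathbb Z$, $\sim\in\{<,\le,=,\ge,>\}$; edges are $(\ell,g,a,R,\ell')$ with guard $g$, action $a$, reset set $R\subseteq\{x\}$. Symbolic states are pairs $(\ell,C)$ with $C$ a constraint over $\{x\}\cup P$. $C\!\uparrow$ (time elapsing) is satisfied by $(w+d,v)$ whenever $(w,v)\models C$, $d\ge0$; $C[R]$ sets the clocks in $R$ to $0$ (existentially eliminating their old values). The initial symbolic state is $(\ell_0,(x=0)\!\uparrow\wedge I(\ell_0))$; for an edge $e=(\ell,g,a,R,\ell')$, the successor of $(\ell,C)$ is $(\ell',((C\wedge g)[R])\!\uparrow\wedge I(\ell'))$ if this constraint is satisfiable (none otherwise). The parametric zone graph is the transition system of symbolic states reachable from the initial one via successors (constraints identified up to equivalence). *)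

theory Defs
  imports Complex_Main "HOL-Library.FuncSet"
begin

section \<open>Syntax of extended 1-clock parametric timed automata\<close>

datatype rel = Lt | Le | Eq | Ge | Gt

fun rel_holds :: "rel \<Rightarrow> real \<Rightarrow> real \<Rightarrow> bool" where
  "rel_holds Lt a b \<longleftrightarrow> a < b"
| "rel_holds Le a b \<longleftrightarrow> a \<le> b"
| "rel_holds Eq a b \<longleftrightarrow> a = b"
| "rel_holds Ge a b \<longleftrightarrow> a \<ge> b"
| "rel_holds Gt a b \<longleftrightarrow> a > b"

text \<open>The atom \<open>\<lparr>cmp = r, coeff = \<alpha>, const = c\<rparr>\<close> stands for the constraint
  \<open>x r (\<Sum>p\<in>P. \<alpha> p * p) + c\<close> on the unique clock \<open>x\<close>; values of \<open>\<alpha>\<close> outside the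
  parameter set \<open>P\<close> of the automaton are never looked at.\<close>

record 'p atom =
  cmp :: rel
  coeff :: "'p \<Rightarrow> int"
  const :: int

text \<open>A guard or invariant is a finite conjunction of atoms; \<open>[]\<close> is \<open>True\<close>.\<close>

type_synonym 'p conj = "'p atom list"

record ('a, 'l, 'c, 'p) edge =
  source :: 'l
  guard :: "'p conj"
  act :: 'a
  resets :: "'c set"
  target :: 'l

record ('a, 'l, 'c, 'p) pta =
  actions :: "'a set"
  locations :: "'l set"
  init_loc :: 'l
  clock :: 'c
  params :: "'p set"
  invariant :: "'l \<Rightarrow> 'p conj"
  edges :: "('a, 'l, 'c, 'p) edge set"

definition extended_1cPTA :: "('a, 'l, 'c, 'p) pta \<Rightarrow> bool" where
  "extended_1cPTA A \<longleftrightarrow>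
     finite (actions A) \<and> finite (locations A) \<and> finite (params A) \<and> finite (edges A) \<and>
     init_loc A \<in> locations A \<and>
     (\<forall>e\<in>edges A. source e \<in> locations A \<and> act e \<in> actions A \<and>
        resets e \<subseteq> {clock A} \<and> target e \<in> locations A)"


section \<open>Constraints up to equivalence\<close>

text \<open>Constraints over the clock and the parameters are identified up to equivalence, so a
  constraint is represented by its set of models \<open>(w, v)\<close>, where \<open>w \<ge> 0\<close> is the real value of
  the clock and \<open>v\<close> assigns a nonnegative rational to each parameter. Valuations are
  extensional (\<open>undefined\<close> outside \<open>params A\<close>), so that two constraints are equal iff they agree
  on all valuations of the parameters of the automaton.\<close>

type_synonym 'p zone = "(real \<times> ('p \<Rightarrow> rat)) set"

definition valuations :: "('a, 'l, 'c, 'p) pta \<Rightarrow> 'p zone" where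
  "valuations A = {0..} \<times> (params A \<rightarrow>\<^sub>E {0..})"

definition sat_atom :: "'p set \<Rightarrow> real \<Rightarrow> ('p \<Rightarrow> rat) \<Rightarrow> 'p atom \<Rightarrow> bool" where
  "sat_atom P w v a \<longleftrightarrow>
     rel_holds (cmp a) w
       ((\<Sum>p\<in>P. of_int (coeff a p) * of_rat (v p)) + of_int (const a))"

definition models :: "('a, 'l, 'c, 'p) pta \<Rightarrow> 'p conj \<Rightarrow> 'p zone" where
  "models A g = {(w, v) \<in> valuations A. \<forall>a\<in>set g. sat_atom (params A) w v a}"

definition elapse :: "'p zone \<Rightarrow> 'p zone" where
  "elapse C = {(w + d, v) | w d v. (w, v) \<in> C \<and> d \<ge> 0}"

definition reset :: "('a, 'l, 'c, 'p) pta \<Rightarrow> 'c set \<Rightarrow> 'p zone \<Rightarrow> 'p zone" where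
  "reset A R C = {(if clock A \<in> R then 0 else w, v) | w v. (w, v) \<in> C}"


section \<open>The parametric zone graph\<close>

type_synonym ('l, 'p) sym_state = "'l \<times> 'p zone"

definition init_state :: "('a, 'l, 'c, 'p) pta \<Rightarrow> ('l, 'p) sym_state" where
  "init_state A =
     (init_loc A,
      elapse {(w, v) \<in> valuations A. w = 0} \<inter> models A (invariant A (init_loc A)))"

definition succ_zone ::
    "('a, 'l, 'c, 'p) pta \<Rightarrow> ('a, 'l, 'c, 'p) edge \<Rightarrow> 'p zone \<Rightarrow> 'p zone" where
  "succ_zone A e C =
     elapse (reset A (resets e) (C \<inter> models A (guard e))) \<inter> models A (invariant A (target e))"

definition sym_step ::
    "('a, 'l, 'c, 'p) pta \<Rightarrow> ('l, 'p) sym_state \<Rightarrow> ('a, 'l, 'c, 'p) edge \<Rightarrow>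
     ('l, 'p) sym_state \<Rightarrow> bool" where
  "sym_step A s e s' \<longleftrightarrow>
     e \<in> edges A \<and> fst s = source e \<and>
     succ_zone A e (snd s) \<noteq> {} \<and> s' = (target e, succ_zone A e (snd s))"

inductive_set reachable_states ::
    "('a, 'l, 'c, 'p) pta \<Rightarrow> ('l, 'p) sym_state set"
  for A :: "('a, 'l, 'c, 'p) pta" where
  init: "init_state A \<in> reachable_states A"
| step: "s \<in> reachable_states A \<Longrightarrow> sym_step A s e s' \<Longrightarrow> s' \<in> reachable_states A"

record ('s, 'e) transition_system =
  states :: "'s set"
  initial :: 's
  transitions :: "('s \<times> 'e \<times> 's) set"

definition finite_ts :: "('s, 'e) transition_system \<Rightarrow> bool" where
  "finite_ts T \<longleftrightarrow> finite (states T) \<and> finite (transitions T)"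

definition parametric_zone_graph ::
    "('a, 'l, 'c, 'p) pta \<Rightarrow>
     (('l, 'p) sym_state, ('a, 'l, 'c, 'p) edge) transition_system" where
  "parametric_zone_graph A =
     \<lparr>states = reachable_states A,
      initial = init_state A,
      transitions = {(s, e, s'). s \<in> reachable_states A \<and> sym_step A s e s'}\<rparr>"

end

(* Let T be the finite set of linear expressions over the parameters that occur in the automaton,
   together with 0. Call two pairs (w, v) and (w', v') equivalent if v and v' order the values of
   the expressions in T in the same way and w, w' occupy the same position among these values.
   There are finitely many classes, and every reachable zone is a union of classes: guards and
   invariants only look at the position of the clock, resetting moves the clock to 0 (which is in
   T), and for resetting and time elapsing a clock value can be carried from v to an equally
   ordered v' because the reals are dense and unbounded. *)

theory Submission imports Defs begin

definition lin_expr :: "'p set \<Rightarrow> 'p atom \<Rightarrow> ('p \<Rightarrow> rat) \<Rightarrow> real" where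
  "lin_expr P a v = (\<Sum>p\<in>P. of_int (coeff a p) * of_rat (v p)) + of_int (const a)"

text \<open>The equivalence class of a pair. It records expressions rather than their values, so
  that signatures under different parameter valuations can be compared. Strict comparisons suffice:
  two values are equal when neither is below the other.\<close>

definition signature ::
    "('v \<Rightarrow> real) set \<Rightarrow> real \<times> 'v \<Rightarrow>
     (('v \<Rightarrow> real) \<times> ('v \<Rightarrow> real)) set \<times> ('v \<Rightarrow> real) set \<times> ('v \<Rightarrow> real) set" where
  "signature T z =
     ({(s, t) \<in> T \<times> T. s (snd z) < t (snd z)},
      {t \<in> T. fst z < t (snd z)}, {t \<in> T. t (snd z) < fst z})"

text \<open>The unions of classes, taken relative to \<open>V\<close> because a signature does not
  see whether parameter values are admissible.\<close>

definition saturated ::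
    "(real \<times> 'v) set \<Rightarrow> ('v \<Rightarrow> real) set \<Rightarrow> (real \<times> 'v) set \<Rightarrow> bool" where
  "saturated V T C \<longleftrightarrow>
     C \<subseteq> V \<and> (\<forall>x\<in>C. \<forall>y\<in>V. signature T x = signature T y \<longrightarrow> y \<in> C)"

lemma signature_eq_iff:
  "signature T (w, v) = signature T (w', v') \<longleftrightarrow>
     (\<forall>s\<in>T. \<forall>t\<in>T. s v < t v \<longleftrightarrow> s v' < t v') \<and>
     (\<forall>t\<in>T. w < t v \<longleftrightarrow> w' < t v') \<and> (\<forall>t\<in>T. t v < w \<longleftrightarrow> t v' < w')"
  by (auto simp: signature_def set_eq_iff)

text \<open>A saturated set is recovered from the signatures of its elements, and a finite
  \<open>T\<close> admits only finitely many signatures.\<close>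

lemma finite_saturated:
  assumes "finite T"
  shows "finite {C. saturated V T C}"
proof -
  have "range (signature T) \<subseteq> Pow (T \<times> T) \<times> Pow T \<times> Pow T"
    by (auto simp: signature_def)
  then have fin: "finite (range (signature T))"
    by (rule finite_subset) (simp add: assms)
  have "C = signature T -` (signature T ` C) \<inter> V" if "saturated V T C" for C
    using that unfolding saturated_def by (auto 4 4)
  then have "{C. saturated V T C} \<subseteq> (\<lambda>S. signature T -` S \<inter> V) ` Pow (range (signature T))"
    by blast
  then show ?thesis
    by (rule finite_subset) (simp add: fin)
qed

lemma saturated_Int:
  "saturated V T C \<Longrightarrow> saturated V T D \<Longrightarrow> saturated V T (C \<inter> D)"
  unfolding saturated_def by blast

lemma exists_between_finite:
  fixes L U :: "real set"
  assumes "finite L" "finite U" "L \<noteq> {}" "\<And>l u. l \<in> L \<Longrightarrow> u \<in> U \<Longrightarrow> l < u"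
  shows "\<exists>w. (\<forall>l\<in>L. l < w) \<and> (\<forall>u\<in>U. w < u)"
proof (cases "U = {}")
  case True
  then show ?thesis
    using assms by (metis Max_less_iff gt_ex empty_iff)
next
  case False
  then have "Max L < Min U"
    using assms by simp
  then obtain w where "Max L < w" "w < Min U"
    using dense by blast
  then show ?thesis
    using assms False by auto
qed

text \<open>The pairs with clocks \<open>u\<close> and \<open>u'\<close> serve only to state that
  \<open>v\<close> and \<open>v'\<close> order \<open>T\<close> alike. The new clock value copies
  the position of \<open>w\<close>: on the value of an expression, or strictly inside a gap.\<close>

lemma signature_transfer:
  assumes "finite T" "(\<lambda>v. 0) \<in> T" "w \<ge> 0"
    and sig: "signature T (u, v) = signature T (u', v')"
  shows "\<exists>w'\<ge>0. signature T (w, v) = signature T (w', v')"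
proof -
  have order: "s v < t v \<longleftrightarrow> s v' < t v'" if "s \<in> T" "t \<in> T" for s t
    using sig that unfolding signature_eq_iff by simp
  have "\<exists>w'. signature T (w, v) = signature T (w', v')"
  proof (cases "\<exists>t\<in>T. t v = w")
    case True
    then obtain t where "t \<in> T" "t v = w" by blast
    then have "signature T (w, v) = signature T (t v', v')"
      using order by (auto simp: signature_eq_iff)
    then show ?thesis by blast
  next
    case False
    define L where "L = {t \<in> T. t v < w}"
    define U where "U = {t \<in> T. w < t v}"
    have T: "T = L \<union> U"
      using False by (auto simp: L_def U_def)
    \<comment> \<open>No expression takes the value \<open>w\<close>, so \<open>w\<close> is
      strictly positive and the gap around it is bounded below.\<close>
    have "(\<lambda>v. 0) \<in> L"
      using assms(2,3) False by (force simp: L_def)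
    moreover have "l v' < u v'" if "l \<in> L" "u \<in> U" for l u
      using that order[of l u] by (auto simp: L_def U_def)
    moreover have "finite L" "finite U"
      using assms(1) by (auto simp: L_def U_def)
    ultimately obtain w' where
      "\<forall>l\<in>(\<lambda>t. t v') ` L. l < w'" "\<forall>u\<in>(\<lambda>t. t v') ` U. w' < u"
      using exists_between_finite[of "(\<lambda>t. t v') ` L" "(\<lambda>t. t v') ` U"] by blast
    then have w': "\<And>t. t \<in> L \<Longrightarrow> t v' < w'" "\<And>t. t \<in> U \<Longrightarrow> w' < t v'"
      by auto
    have "(w < t v \<longleftrightarrow> w' < t v') \<and> (t v < w \<longleftrightarrow> t v' < w')" if "t \<in> T" for t
    proof (cases "t \<in> L")
      case True
      then show ?thesis using w'(1)[of t] by (auto simp: L_def)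
    next
      case False
      then have "t \<in> U" using that T by blast
      then show ?thesis using w'(2)[of t] by (auto simp: U_def)
    qed
    then have "signature T (w, v) = signature T (w', v')"
      using order by (simp add: signature_eq_iff)
    then show ?thesis by blast
  qed
  then obtain w' where w': "signature T (w, v) = signature T (w', v')" by blast
  \<comment> \<open>Zero belongs to \<open>T\<close>, so the signature determines the sign of the
    clock.\<close>
  then have "\<not> w' < 0"
    using assms(2,3) unfolding signature_eq_iff by force
  then have "w' \<ge> 0" by simp
  with w' show ?thesis by blast
qed

text \<open>Clock values in different positions have the value of some \<open>t\<close> weakly
  between them, and the same \<open>t\<close> separates the transferred values. Within a single
  position the order could be reversed.\<close>

lemma signature_le_transfer:
  assumes "w \<le> u"
    and "signature T (w, v) = signature T (w', v')"
    and "signature T (u, v) = signature T (u', v')"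
    and "signature T (w, v) \<noteq> signature T (u, v)"
  shows "w' \<le> u'"
proof -
  have "\<exists>t\<in>T. w \<le> t v \<and> t v \<le> u"
  proof (rule ccontr)
    assume "\<not> ?thesis"
    then have "t v < w \<or> u < t v" if "t \<in> T" for t
      using that by (meson not_le)
    then have "(w < t v \<longleftrightarrow> u < t v) \<and> (t v < w \<longleftrightarrow> t v < u)" if "t \<in> T" for t
      using that assms(1) by force
    with assms(4) show False
      by (simp add: signature_eq_iff)
  qed
  then obtain t where t: "t \<in> T" "w \<le> t v" "t v \<le> u" by blast
  then have "w' \<le> t v'" "t v' \<le> u'"
    using assms(2,3) unfolding signature_eq_iff by (meson not_le)+
  then show ?thesis by simp
qed

lemma saturated_elapse:
  assumes "finite T" "(\<lambda>v. 0) \<in> T" "saturated (valuations A) T C"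
  shows "saturated (valuations A) T (elapse C)"
  unfolding saturated_def
proof (intro conjI ballI impI)
  show "elapse C \<subseteq> valuations A"
    using assms(3) by (force simp: saturated_def elapse_def valuations_def)
next
  fix x y
  assume "x \<in> elapse C" and y: "y \<in> valuations A" and sig: "signature T x = signature T y"
  then obtain w d v where x: "x = (w + d, v)" and C: "(w, v) \<in> C" and d: "d \<ge> 0"
    by (auto simp: elapse_def)
  obtain u' v' where y': "y = (u', v')" by fastforce
  have closed: "(w', v') \<in> C" if "w' \<ge> 0" "signature T (w, v) = signature T (w', v')" for w'
    using assms(3) C y that unfolding saturated_def y' valuations_def by blast
  have "\<exists>w'\<le>u'. (w', v') \<in> C"
  \<comment> \<open>If the delay stays within one class, \<open>y\<close> itself lies in
    \<open>C\<close> and delay 0 works. Otherwise the starting point is carried to \<open>v'\<close>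
    and remains before \<open>u'\<close>.\<close>
  proof (cases "signature T (w, v) = signature T (w + d, v)")
    case True
    then show ?thesis
      using closed[of u'] sig y by (auto simp: x y' valuations_def)
  next
    case False
    have "w \<ge> 0"
      using assms(3) C by (auto simp: saturated_def valuations_def)
    then obtain w' where "w' \<ge> 0" and w': "signature T (w, v) = signature T (w', v')"
      using signature_transfer[OF assms(1,2) _ sig[unfolded x y']] by blast
    then show ?thesis
      using closed signature_le_transfer[OF _ w' _ False, of u'] sig d by (auto simp: x y')
  qed
  then obtain w' where "w' \<le> u'" "(w', v') \<in> C" by blast
  then have "u' = w' + (u' - w')" "(w', v') \<in> C" "u' - w' \<ge> 0" by auto
  then show "y \<in> elapse C"
    unfolding elapse_def y' by blast
qed

lemma saturated_reset:
  assumes "finite T" "(\<lambda>v. 0) \<in> T" "saturated (valuations A) T C"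
  shows "saturated (valuations A) T (reset A R C)"
proof (cases "clock A \<in> R")
  case False
  then have "reset A R C = C" by (auto simp: reset_def)
  then show ?thesis using assms(3) by simp
next
  case True
  then have reset: "reset A R C = {(0, v) | w v. (w, v) \<in> C}"
    by (simp add: reset_def)
  show ?thesis
    unfolding saturated_def
  proof (intro conjI ballI impI)
    show "reset A R C \<subseteq> valuations A"
      using assms(3) by (force simp: saturated_def reset valuations_def)
  next
    fix x y
    assume "x \<in> reset A R C" and y: "y \<in> valuations A" and sig: "signature T x = signature T y"
    then obtain w v where x: "x = (0, v)" and C: "(w, v) \<in> C"
      by (auto simp: reset)
    obtain u' v' where y': "y = (u', v')" by fastforce
    \<comment> \<open>The expression 0 makes the clock value 0 a position of its own.\<close>
    have "u' = 0"
      using sig assms(2) unfolding x y' signature_eq_iff by force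
    have "w \<ge> 0"
      using assms(3) C by (auto simp: saturated_def valuations_def)
    \<comment> \<open>The clock value erased by the reset is carried to \<open>v'\<close>, giving a
      preimage of \<open>y\<close>.\<close>
    then obtain w' where "w' \<ge> 0" "signature T (w, v) = signature T (w', v')"
      using signature_transfer[OF assms(1,2) _ sig[unfolded x y']] by blast
    then have "(w', v') \<in> C"
      using assms(3) C y unfolding saturated_def y' valuations_def by blast
    then show "y \<in> reset A R C"
      by (auto simp: reset y' \<open>u' = 0\<close>)
  qed
qed

lemma sat_atom_cong:
  assumes "signature T (w, v) = signature T (w', v')" "lin_expr P a \<in> T"
  shows "sat_atom P w v a \<longleftrightarrow> sat_atom P w' v' a"
proof -
  have "w < lin_expr P a v \<longleftrightarrow> w' < lin_expr P a v'" "lin_expr P a v < w \<longleftrightarrow> lin_expr P a v' < w'"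
    using assms unfolding signature_eq_iff by blast+
  then show ?thesis
    unfolding sat_atom_def lin_expr_def[symmetric] by (cases "cmp a") auto
qed

lemma saturated_models:
  assumes "lin_expr (params A) ` set g \<subseteq> T"
  shows "saturated (valuations A) T (models A g)"
  unfolding saturated_def
proof (intro conjI ballI impI)
  show "models A g \<subseteq> valuations A"
    by (auto simp: models_def)
next
  fix x y
  assume "x \<in> models A g" "y \<in> valuations A" "signature T x = signature T y"
  then show "y \<in> models A g"
    using assms sat_atom_cong[of T "fst x" "snd x" "fst y" "snd y" "params A"]
    by (auto simp: models_def image_subset_iff)
qed

lemma saturated_zero:
  assumes "(\<lambda>v. 0) \<in> T"
  shows "saturated (valuations A) T {(w, v) \<in> valuations A. w = 0}"
  unfolding saturated_def using assms by (force simp: signature_eq_iff)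

lemma reachable_saturated:
  assumes "finite T" "(\<lambda>v. 0) \<in> T"
    and "lin_expr (params A) ` set (invariant A (init_loc A)) \<subseteq> T"
    and "\<And>e. e \<in> edges A \<Longrightarrow>
           lin_expr (params A) ` (set (guard e) \<union> set (invariant A (target e))) \<subseteq> T"
    and "s \<in> reachable_states A"
  shows "fst s \<in> insert (init_loc A) (target ` edges A) \<and> saturated (valuations A) T (snd s)"
  using assms(5)
proof induction
  case init
  show ?case
    using assms(1-3)
    by (simp add: init_state_def saturated_Int saturated_elapse saturated_zero saturated_models)
next
  case (step s e s')
  then show ?case
    using assms(1,2) assms(4)[of e]
    by (auto simp: sym_step_def succ_zone_def image_Un
        intro!: saturated_Int saturated_elapse saturated_reset saturated_models)
qed

theorem theorem5p4:
  fixes A :: "('a, 'l, 'c, 'p) pta"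
  assumes "extended_1cPTA A"
  shows "finite_ts (parametric_zone_graph A)"
proof -
  \<comment> \<open>Zones only ever meet the invariants of the initial location and of edge targets.
    Collecting just these keeps \<open>T\<close> finite even if the type of locations is
    infinite.\<close>
  define T where "T = insert (\<lambda>v. 0) (lin_expr (params A) `
    (set (invariant A (init_loc A)) \<union>
     (\<Union>e\<in>edges A. set (guard e) \<union> set (invariant A (target e)))))"
  have fin: "finite (edges A)"
    using assms by (simp add: extended_1cPTA_def)
  then have "finite T"
    by (simp add: T_def)
  have "reachable_states A \<subseteq>
      insert (init_loc A) (target ` edges A) \<times> {C. saturated (valuations A) T C}"
  proof
    fix s
    assume "s \<in> reachable_states A"
    then have "fst s \<in> insert (init_loc A) (target ` edges A) \<and> saturated (valuations A) T (snd s)"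
      by (rule reachable_saturated[OF \<open>finite T\<close>, rotated -1]) (auto simp: T_def)
    then show "s \<in> insert (init_loc A) (target ` edges A) \<times> {C. saturated (valuations A) T C}"
      by (simp add: mem_Times_iff)
  qed
  then have states: "finite (reachable_states A)"
    by (rule finite_subset) (simp add: fin finite_saturated \<open>finite T\<close>)
  have "{(s, e, s'). s \<in> reachable_states A \<and> sym_step A s e s'} \<subseteq>
      reachable_states A \<times> edges A \<times> reachable_states A"
    by (auto simp: sym_step_def intro: reachable_states.step[unfolded sym_step_def])
  then have "finite {(s, e, s'). s \<in> reachable_states A \<and> sym_step A s e s'}"
    by (rule finite_subset) (simp add: fin states)
  with states show ?thesis
    by (simp add: finite_ts_def parametric_zone_graph_def)
qed

end
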